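(* Let $Y$ be a finite dimensional Euclidean space, $K\subseteq Y$ a closed convex cone, $A:\mathbb{R}^m\to Y$ an injective linear map, $b\in Y$, $c\in\mathbb{R}^m$, and suppose that $$(D)\qquad \inf\ \langle b,y\rangle\quad\text{s.t.}\quad A^*y=c,\ y\in K^*$$ is feasible. Then the equality constraints of $(D)$ have a reformulation, with the objective vector $b$ unchanged, such that the problem obtained after also changing the underlying cone, $$\begin{array}{rl}\inf & \langle b,y\rangle\\ \text{s.t.} & \langle a_i',y\rangle=0\ (i=1,\dots,k),\\ & \langle a_i',y\rangle=c_i'\ (i=k+1,\dots,m),\\ & y\in K^*\cap a_1'^{\perp}\cap\dots\cap a_k'^{\perp},\end{array}$$ is strictly feasible, where $k\ge0$ and $(a_1',\dots,a_k')\in\mathrm{FR}_k(K^* )$. Moreover $(a_1',\dots,a_k')$ can be chosen strict.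
   Context: $K^*=\{y\in Y:\langle y,x\rangle\ge0\ \forall x\in K\}$; $A^*$ is the adjoint of $A$; $S^\perp$ is the orthogonal complement of the linear span of $S$. Write $Ax=\sum_{i=1}^m x_ia_i$, so $A^*y=(\langle a_1,y\rangle,\dots,\langle a_m,y\rangle)^T$. Reformulation (for the equality constraints, keeping $b$): a finite sequence of the operations: replace $(a_i,c_i)$ by $(A\lambda,\langle c,\lambda\rangle)$ for some $i$ and some $\lambda\in\mathbb{R}^m$ with $\lambda_i\ne0$; switch $(a_i,c_i)$ with $(a_j,c_j)$, $i\neq j$. Equivalently, $A$ is replaced by $A'=AM$ and $c$ by $c'=M^Tc$ for an invertible $m\times m$ matrix $M$; $a_i'$ denotes the vectors representing $A'$. Strictly feasible: a problem with affine constraints and constraint $y\in C$, $C$ a closed convex cone, is strictly feasible if some $y$ in the relative interior of $C$ satisfies the affine constraints. For a closed convex cone $C$ and $k\ge1$, $\mathrm{FR}_k(C)=\{(y_1,\dots,y_k): y_1\in C^*,\ y_i\in(C\cap y_1^\perp\cap\dots\cap y_{i-1}^\perp)^*,\ i=2,\dots,k\}$; an element is strict if for $i=1,\dots,k$, $y_i\in C_i^*\setminus C_i^\perp$ with $C_i=C\cap y_1^\perp\cap\dots\cap y_{i-1}^\perp$ ($C_1=C$). For $k=0$ the sequence is empty and these conditions are vacuous. *)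

theory Defs
  imports "HOL-Analysis.Analysis"
begin

(* R^m is the set of real families supported on the index set {1..m}. A term-level m covers
   m = 0 and gives the coordinates the order 1, ..., m that the reduced problem refers to. *)

definition Rvec :: "nat \<Rightarrow> (nat \<Rightarrow> real) set" where
  "Rvec m = {x. \<forall>i. i \<notin> {1..m} \<longrightarrow> x i = 0}"

definition Rinner :: "nat \<Rightarrow> (nat \<Rightarrow> real) \<Rightarrow> (nat \<Rightarrow> real) \<Rightarrow> real" where
  "Rinner m x z = (\<Sum>i = 1..m. x i * z i)"

(* A linear map A from R^m is given by the vectors a 1, ..., a m representing it. *)

definition lin_op :: "nat \<Rightarrow> (nat \<Rightarrow> 'a::real_vector) \<Rightarrow> (nat \<Rightarrow> real) \<Rightarrow> 'a" where
  "lin_op m a x = (\<Sum>i = 1..m. x i *\<^sub>R a i)"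

definition op_adjoint :: "nat \<Rightarrow> (nat \<Rightarrow> 'a::real_inner) \<Rightarrow> 'a \<Rightarrow> (nat \<Rightarrow> real)" where
  "op_adjoint m a y = (\<lambda>i. if i \<in> {1..m} then a i \<bullet> y else 0)"

lemma op_adjoint_Rvec: "op_adjoint m a y \<in> Rvec m"
  by (simp add: op_adjoint_def Rvec_def)

lemma op_adjoint_inner: "Rinner m (op_adjoint m a y) x = y \<bullet> lin_op m a x"
  by (simp add: Rinner_def op_adjoint_def lin_op_def inner_sum_right inner_commute mult.commute)

lemma op_adjoint_eq_iff:
  assumes "c \<in> Rvec m"
  shows "op_adjoint m a y = c \<longleftrightarrow> (\<forall>i \<in> {1..m}. a i \<bullet> y = c i)"
  using assms by (auto simp: op_adjoint_def Rvec_def fun_eq_iff)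

definition dual_cone :: "'a::real_inner set \<Rightarrow> 'a set" where
  "dual_cone C = {y. \<forall>x \<in> C. y \<bullet> x \<ge> 0}"

definition perp :: "'a::real_inner set \<Rightarrow> 'a set" where
  "perp S = orthogonal_comp (span S)"

(* The problem  inf <objective, y>  s.t.  <lhs i, y> = rhs i (i = 1..neqs), y in the given cone. *)

record 'a conic_problem =
  objective :: 'a
  neqs :: nat
  lhs :: "nat \<Rightarrow> 'a"
  rhs :: "nat \<Rightarrow> real"
  the_cone :: "'a set"

definition affine_constraints :: "('a::real_inner) conic_problem \<Rightarrow> 'a set" where
  "affine_constraints P = {y. op_adjoint (neqs P) (lhs P) y = rhs P}"

definition feasible :: "('a::real_inner) conic_problem \<Rightarrow> bool" where
  "feasible P \<longleftrightarrow> (\<exists>y \<in> the_cone P. y \<in> affine_constraints P)"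

definition strictly_feasible :: "('a::euclidean_space) conic_problem \<Rightarrow> bool" where
  "strictly_feasible P \<longleftrightarrow> (\<exists>y \<in> rel_interior (the_cone P). y \<in> affine_constraints P)"

inductive reformulation ::
  "nat \<Rightarrow> (nat \<Rightarrow> 'a::real_vector) \<Rightarrow> (nat \<Rightarrow> real) \<Rightarrow> (nat \<Rightarrow> 'a) \<Rightarrow> (nat \<Rightarrow> real) \<Rightarrow> bool"
  for m a c where
  start: "reformulation m a c a c"
| replace: "reformulation m a c a' c' \<Longrightarrow> i \<in> {1..m} \<Longrightarrow> l \<in> Rvec m \<Longrightarrow> l i \<noteq> 0 \<Longrightarrow>
    reformulation m a c (a'(i := lin_op m a' l)) (c'(i := Rinner m c' l))"
| switch: "reformulation m a c a' c' \<Longrightarrow> i \<in> {1..m} \<Longrightarrow> j \<in> {1..m} \<Longrightarrow> i \<noteq> j \<Longrightarrow>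
    reformulation m a c (a'(i := a' j, j := a' i)) (c'(i := c' j, j := c' i))"

definition fr_face :: "'a::real_inner set \<Rightarrow> (nat \<Rightarrow> 'a) \<Rightarrow> nat \<Rightarrow> 'a set" where
  "fr_face C y i = C \<inter> (\<Inter>j \<in> {1..<i}. perp {y j})"

(* A sequence (y 1, ..., y k) is the restriction of a family y to {1..k}; other values of y
   are irrelevant. *)

definition FR :: "nat \<Rightarrow> 'a::real_inner set \<Rightarrow> (nat \<Rightarrow> 'a) set" where
  "FR k C = {y. \<forall>i \<in> {1..k}. y i \<in> dual_cone (fr_face C y i)}"

definition strict_FR :: "nat \<Rightarrow> 'a::real_inner set \<Rightarrow> (nat \<Rightarrow> 'a) \<Rightarrow> bool" where
  "strict_FR k C y \<longleftrightarrow>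
    (\<forall>i \<in> {1..k}. y i \<in> dual_cone (fr_face C y i) - perp (fr_face C y i))"

definition dual_problem ::
  "'a::real_inner \<Rightarrow> nat \<Rightarrow> (nat \<Rightarrow> 'a) \<Rightarrow> (nat \<Rightarrow> real) \<Rightarrow> 'a set \<Rightarrow> 'a conic_problem" where
  "dual_problem b m a c K =
    \<lparr>objective = b, neqs = m, lhs = a, rhs = c, the_cone = dual_cone K\<rparr>"

definition reduced_problem ::
  "'a::real_inner \<Rightarrow> nat \<Rightarrow> (nat \<Rightarrow> 'a) \<Rightarrow> (nat \<Rightarrow> real) \<Rightarrow> nat \<Rightarrow> 'a set \<Rightarrow> 'a conic_problem" where
  "reduced_problem b m a c k K =
    \<lparr>objective = b, neqs = m, lhs = a, rhs = (\<lambda>i. if i \<in> {1..k} then 0 else c i),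
     the_cone = dual_cone K \<inter> (\<Inter>i \<in> {1..k}. perp {a i})\<rparr>"

end

theory Submission
  imports Defs
begin

text \<open>The proof is facial reduction by a theorem of the alternative. Call \<open>C\<close> the current cone
  (initially \<open>K\<^sup>*\<close>), and let \<open>y\<^sub>0 \<in> C\<close> satisfy the equality constraints. Either a point of the
  relative interior of \<open>C\<close> satisfies them as well, or some combination \<open>w = A \<lambda>\<close> of the
  constraint vectors is nonnegative on \<open>C\<close>, does not vanish identically there, and has
  right-hand side \<open>\<langle>c, \<lambda>\<rangle> = 0\<close>; this is \<open>rel_interior_solution_alternative\<close>, which applies a
  supporting hyperplane to the image of \<open>C\<close> under \<open>A A\<^sup>*\<close>.

  In the second case \<open>w\<close> becomes the next constraint vector and \<open>C\<close> shrinks to \<open>C \<inter> w\<^sup>\<bottom>\<close>.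
  Adding \<open>w\<close> is a legitimate reformulation that leaves the vectors already chosen in place:
  those vectors are orthogonal to \<open>C\<close> and \<open>w\<close> is not, so \<open>\<lambda>\<close> has a nonzero entry beyond them,
  and \<open>w\<close> may overwrite the constraint at that entry (\<open>reformulation_place\<close>). This also shows
  that fewer than \<open>m\<close> vectors had been chosen. Hence a longest strict facial reduction sequence
  obtainable by reformulation exists, and at its end the first case must hold. The point \<open>y\<^sub>0\<close>
  remains feasible throughout, since reformulations preserve solutions and the vectors chosen
  have right-hand side \<open>0\<close>.\<close>

lemma inner_lin_op: "lin_op m a l \<bullet> y = Rinner m (op_adjoint m a y) l"
  by (simp add: op_adjoint_inner inner_commute)

lemma op_adjoint_upd_lin_op:
  assumes "i \<in> {1..m}"
  shows "op_adjoint m (a(i := lin_op m a l)) y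
           = (op_adjoint m a y)(i := Rinner m (op_adjoint m a y) l)"
  using assms by (auto simp: op_adjoint_def fun_eq_iff inner_lin_op[unfolded op_adjoint_def])

lemma reformulation_preserves_solutions:
  assumes "reformulation m a c a' c'" and "op_adjoint m a y = c"
  shows "op_adjoint m a' y = c'"
  using assms
proof induction
  case start
  then show ?case .
next
  case (replace a' c' i l)
  then show ?case by (simp only: op_adjoint_upd_lin_op)
next
  case (switch a' c' i j)
  then have c': "c' = op_adjoint m a' y" by simp
  show ?case
    using switch.hyps unfolding c' by (auto simp: op_adjoint_def fun_eq_iff)
qed

text \<open>The two elementary operations together put a combination of the constraints into a
  prescribed position \<open>p\<close>, at the expense of a constraint \<open>i\<close> that enters it. Only the
  positions \<open>i\<close> and \<open>p\<close> change.\<close>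

lemma reformulation_place:
  assumes ref: "reformulation m a c a' c'"
    and i: "i \<in> {1..m}" and p: "p \<in> {1..m}"
    and l: "l \<in> Rvec m" and li: "l i \<noteq> 0"
  obtains a'' c'' where "reformulation m a c a'' c''"
    and "a'' p = lin_op m a' l" and "c'' p = Rinner m c' l"
    and "\<And>j. j \<noteq> i \<Longrightarrow> j \<noteq> p \<Longrightarrow> a'' j = a' j \<and> c'' j = c' j"
proof -
  define a1 where "a1 = a'(i := lin_op m a' l)"
  define c1 where "c1 = c'(i := Rinner m c' l)"
  have 1: "reformulation m a c a1 c1"
    unfolding a1_def c1_def using ref i l li by (rule reformulation.replace)
  show thesis
  proof (cases "i = p")
    case True
    then show thesis using that[OF 1] by (simp add: a1_def c1_def)
  next
    case False
    show thesis
      using False that[OF reformulation.switch[OF 1 i p False]] by (simp add: a1_def c1_def)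
  qed
qed

lemma in_perp_singleton_iff: "y \<in> perp {v} \<longleftrightarrow> v \<bullet> y = 0"
  by (auto simp: perp_def orthogonal_comp_def orthogonal_def span_singleton)

lemma inner_eq_0_if_in_perp: "w \<in> perp C \<Longrightarrow> y \<in> C \<Longrightarrow> w \<bullet> y = 0"
  by (auto simp: perp_def orthogonal_comp_def orthogonal_def span_base inner_commute)

lemma in_perp_iff: "w \<in> perp C \<longleftrightarrow> (\<forall>y \<in> C. w \<bullet> y = 0)"
proof
  assume "\<forall>y \<in> C. w \<bullet> y = 0"
  then have "\<And>y. y \<in> C \<Longrightarrow> orthogonal w y" by (simp add: orthogonal_def)
  then have "orthogonal w x" if "x \<in> span C" for x
    using orthogonal_to_span[OF that] by blast
  then show "w \<in> perp C"
    by (simp add: perp_def orthogonal_comp_def orthogonal_commute)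
qed (auto simp: inner_eq_0_if_in_perp)

lemma convex_cone_dual_cone: "convex_cone (dual_cone K)"
  by (auto simp: convex_cone_iff dual_cone_def inner_add_left)

lemma fr_face_Suc: "fr_face C v (Suc k) = C \<inter> (\<Inter>i \<in> {1..k}. perp {v i})"
  by (simp add: fr_face_def atLeastLessThanSuc_atLeastAtMost)

lemma convex_cone_fr_face: "convex_cone C \<Longrightarrow> convex_cone (fr_face C v i)"
  by (auto simp: convex_cone_iff fr_face_def in_perp_singleton_iff inner_add_right)

text \<open>The operator \<open>B = A A\<^sup>*\<close> is self-adjoint with the kernel of \<open>A\<^sup>*\<close>, and maps \<open>Y\<close> to itself.
  If no solution lies in the relative interior of \<open>C\<close>, then \<open>B y\<^sub>0\<close> is not in the relative
  interior of the convex set \<open>B C\<close>, because relative interiors commute with linear maps. A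
  hyperplane with normal \<open>v\<close> that supports \<open>B C\<close> at \<open>B y\<^sub>0\<close> pulls back to \<open>w = B v = A (A\<^sup>* v)\<close>.\<close>

lemma rel_interior_solution_alternative:
  fixes C :: "'a::euclidean_space set"
  assumes C: "convex_cone C" and y0: "y0 \<in> C"
    and none: "\<And>y. y \<in> rel_interior C \<Longrightarrow> op_adjoint m a y \<noteq> op_adjoint m a y0"
  obtains l where "l \<in> Rvec m" and "Rinner m (op_adjoint m a y0) l = 0"
    and "lin_op m a l \<in> dual_cone C - perp C"
proof -
  define B where "B = (\<lambda>y. lin_op m a (op_adjoint m a y))"
  have B_eq: "B y = (\<Sum>i = 1..m. (a i \<bullet> y) *\<^sub>R a i)" for y
    by (simp add: B_def lin_op_def op_adjoint_def)
  have "linear B"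
    unfolding B_eq [abs_def]
    by (intro linear_compose_sum ballI linearI) (simp_all add: inner_add_right scaleR_add_left)
  have B_adj: "v \<bullet> B y = B v \<bullet> y" for v y
    by (simp add: B_eq inner_sum_left inner_sum_right inner_commute mult.commute)
  have B_ker: "op_adjoint m a y = op_adjoint m a z" if "B y = B z" for y z
  proof -
    have "(\<Sum>i = 1..m. (a i \<bullet> (y - z))\<^sup>2) = (y - z) \<bullet> B (y - z)"
      by (simp add: B_eq inner_sum_right power2_eq_square inner_commute)
    also have "\<dots> = 0"
      using that by (simp add: linear_diff[OF \<open>linear B\<close>])
    finally have "\<forall>i \<in> {1..m}. (a i \<bullet> (y - z))\<^sup>2 = 0"
      by (subst (asm) sum_nonneg_eq_0_iff) auto
    then show ?thesis
      by (auto simp: op_adjoint_def fun_eq_iff inner_diff_right)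
  qed
  have convC: "convex C" and C_scale: "\<And>y t. y \<in> C \<Longrightarrow> 0 \<le> t \<Longrightarrow> t *\<^sub>R y \<in> C"
    using C by (auto simp: convex_cone_def conic_def)
  have ri: "rel_interior (B ` C) = B ` rel_interior C"
    by (rule rel_interior_convex_linear_image[OF \<open>linear B\<close> convC, symmetric])
  have convBC: "convex (B ` C)"
    using \<open>linear B\<close> convC by (rule convex_linear_image)
  have "B y0 \<notin> rel_interior (B ` C)"
  proof
    assume "B y0 \<in> rel_interior (B ` C)"
    then obtain y where y: "y \<in> rel_interior C" "B y0 = B y"
      unfolding ri by (rule imageE)
    show False
      using none[OF y(1)] B_ker[OF y(2)] by simp
  qed
  then obtain v where v: "\<And>u. u \<in> B ` C \<Longrightarrow> v \<bullet> B y0 \<le> v \<bullet> u"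
    and v': "\<And>u. u \<in> rel_interior (B ` C) \<Longrightarrow> v \<bullet> B y0 < v \<bullet> u"
    using supporting_hyperplane_rel_boundary[OF convBC imageI[OF y0]] by metis
  define l where "l = op_adjoint m a v"
  have Bv: "B v = lin_op m a l" by (simp add: B_def l_def)
  have ge: "B v \<bullet> y0 \<le> B v \<bullet> y" if "y \<in> C" for y
    using v[OF imageI[OF that]] by (simp add: B_adj)
  \<comment> \<open>Comparing \<open>y\<^sub>0\<close> with its multiples \<open>0\<close> and \<open>2 y\<^sub>0\<close> shows that the hyperplane contains \<open>0\<close>.\<close>
  have zero: "B v \<bullet> y0 = 0"
    using ge[OF C_scale[OF y0, of 0]] ge[OF C_scale[OF y0, of 2]] by simp
  have "rel_interior C \<noteq> {}"
    using y0 convC rel_interior_eq_empty by blast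
  then obtain y where "y \<in> rel_interior C" by blast
  then have "y \<in> C" "B v \<bullet> y \<noteq> 0"
    using v'[of "B y"] rel_interior_subset zero by (auto simp: ri B_adj)
  then have "B v \<notin> perp C" by (auto simp: in_perp_iff)
  moreover have "B v \<in> dual_cone C"
    using ge zero by (simp add: dual_cone_def)
  moreover have "Rinner m (op_adjoint m a y0) l = 0"
    using zero by (simp add: Bv inner_lin_op)
  moreover have "l \<in> Rvec m" by (simp add: l_def op_adjoint_Rvec)
  ultimately show thesis using that Bv by simp
qed

lemma strict_FR_imp_FR: "strict_FR k C v \<Longrightarrow> v \<in> FR k C"
  by (simp add: strict_FR_def FR_def)

lemma fr_face_cong: "(\<And>j. 1 \<le> j \<Longrightarrow> j < i \<Longrightarrow> u j = v j) \<Longrightarrow> fr_face C u i = fr_face C v i"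
  by (simp add: fr_face_def)

lemma strict_FR_Suc:
  assumes "strict_FR k C v" and "\<And>j. 1 \<le> j \<Longrightarrow> j \<le> k \<Longrightarrow> u j = v j"
    and "u (Suc k) \<in> dual_cone (fr_face C v (Suc k)) - perp (fr_face C v (Suc k))"
  shows "strict_FR (Suc k) C u"
  unfolding strict_FR_def
proof
  fix i assume i: "i \<in> {1..Suc k}"
  have "fr_face C u i = fr_face C v i"
    using i assms(2) by (intro fr_face_cong) auto
  then show "u i \<in> dual_cone (fr_face C u i) - perp (fr_face C u i)"
    using i assms by (cases "i = Suc k") (auto simp: strict_FR_def)
qed

text \<open>The combination to be added is not orthogonal to the current face, whereas the vectors
  already chosen are. So it involves a constraint beyond the first \<open>k\<close>, and that constraint can
  give way to it.\<close>

lemma strict_FR_reformulation_extend: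
  assumes ref: "reformulation m a c a' c'"
    and zero: "\<forall>i \<in> {1..k}. c' i = 0" and FR: "strict_FR k C a'"
    and l: "l \<in> Rvec m" "Rinner m c' l = 0"
    and w: "lin_op m a' l \<in> dual_cone (fr_face C a' (Suc k)) - perp (fr_face C a' (Suc k))"
  shows "k < m \<and> (\<exists>a'' c''. reformulation m a c a'' c'' \<and>
           (\<forall>i \<in> {1..Suc k}. c'' i = 0) \<and> strict_FR (Suc k) C a'')"
proof -
  obtain y where y: "y \<in> fr_face C a' (Suc k)" "lin_op m a' l \<bullet> y \<noteq> 0"
    using w in_perp_iff by blast
  have "a' i \<bullet> y = 0" if "i \<in> {1..k}" for i
    using y(1) that by (auto simp: fr_face_Suc in_perp_singleton_iff)
  moreover obtain i where i: "i \<in> {1..m}" "l i * (a' i \<bullet> y) \<noteq> 0"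
    using y(2) by (auto simp: lin_op_def inner_sum_left elim: sum.not_neutral_contains_not_neutral)
  ultimately have ik: "i \<notin> {1..k}" and li: "l i \<noteq> 0" by auto
  have p: "Suc k \<in> {1..m}" using i(1) ik by auto
  obtain a'' c'' where "reformulation m a c a'' c''"
    and new: "a'' (Suc k) = lin_op m a' l" "c'' (Suc k) = Rinner m c' l"
    and old: "\<And>j. j \<noteq> i \<Longrightarrow> j \<noteq> Suc k \<Longrightarrow> a'' j = a' j \<and> c'' j = c' j"
    using reformulation_place[OF ref i(1) p l(1) li] by metis
  moreover have "a'' j = a' j \<and> c'' j = c' j" if "1 \<le> j" "j \<le> k" for j
    using that ik by (intro old) auto
  moreover from this have "\<forall>i \<in> {1..Suc k}. c'' i = 0"
    using zero new l(2) by (auto simp: le_Suc_eq)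
  moreover have "strict_FR (Suc k) C a''"
    using calculation w by (intro strict_FR_Suc[OF FR]) auto
  ultimately show ?thesis using p by auto
qed

theorem theorem3:
  fixes K :: "'a::euclidean_space set"
    and m :: nat
    and a :: "nat \<Rightarrow> 'a"
    and b :: 'a
    and c :: "nat \<Rightarrow> real"
  assumes "closed K" and "convex_cone K"
    and "inj_on (lin_op m a) (Rvec m)"
    and "c \<in> Rvec m"
    and "feasible (dual_problem b m a c K)"
  shows "\<exists>a' c' k.
      reformulation m a c a' c' \<and>
      k \<le> m \<and>
      (\<forall>i \<in> {1..k}. c' i = 0) \<and>
      strictly_feasible (reduced_problem b m a' c' k K) \<and>
      a' \<in> FR k (dual_cone K) \<and>
      strict_FR k (dual_cone K) a'"
proof -
  define C where "C = dual_cone K"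
  obtain y0 where y0: "y0 \<in> C" "op_adjoint m a y0 = c"
    using assms(5) by (auto simp: feasible_def affine_constraints_def dual_problem_def C_def)
  define reached where "reached = (\<lambda>k. k \<le> m \<and> (\<exists>a' c'. reformulation m a c a' c' \<and>
    (\<forall>i \<in> {1..k}. c' i = 0) \<and> strict_FR k C a'))"
  have "reached 0"
    by (auto simp: reached_def strict_FR_def intro: reformulation.start)
  moreover have bound: "\<And>k. reached k \<Longrightarrow> k \<le> m"
    by (simp add: reached_def)
  ultimately obtain k where k: "reached k" and maximal: "\<not> reached (Suc k)"
    by (metis GreatestI_nat Greatest_le_nat Suc_n_not_le_n)
  obtain a' c' where ref: "reformulation m a c a' c'"
    and zero: "\<forall>i \<in> {1..k}. c' i = 0" and FR: "strict_FR k C a'" and "k \<le> m"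
    using k by (auto simp: reached_def)
  have sol: "op_adjoint m a' y0 = c'"
    by (rule reformulation_preserves_solutions[OF ref y0(2)])
  define F where "F = fr_face C a' (Suc k)"
  have "a' i \<bullet> y0 = 0" if "i \<in> {1..k}" for i
    using fun_cong[OF sol, of i] zero that \<open>k \<le> m\<close> by (simp add: op_adjoint_def)
  then have "y0 \<in> F"
    using y0(1) by (simp add: F_def fr_face_Suc in_perp_singleton_iff)
  have "convex_cone F"
    unfolding F_def C_def by (intro convex_cone_fr_face convex_cone_dual_cone)
  have "\<exists>y \<in> rel_interior F. op_adjoint m a' y = c'"
  proof (rule ccontr)
    assume "\<not> ?thesis"
    then obtain l where "l \<in> Rvec m" "Rinner m c' l = 0" "lin_op m a' l \<in> dual_cone F - perp F"
      using rel_interior_solution_alternative[OF \<open>convex_cone F\<close> \<open>y0 \<in> F\<close>, of m a'] sol by metis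
    then have "reached (Suc k)"
      using strict_FR_reformulation_extend[OF ref zero FR] unfolding reached_def F_def Suc_le_eq
      by blast
    with maximal show False ..
  qed
  moreover have "(\<lambda>i. if i \<in> {1..k} then 0 else c' i) = c'"
    using zero by auto
  ultimately have "strictly_feasible (reduced_problem b m a' c' k K)"
    unfolding strictly_feasible_def reduced_problem_def affine_constraints_def
    by (simp add: F_def fr_face_Suc C_def)
  then show ?thesis
    using ref zero FR \<open>k \<le> m\<close> strict_FR_imp_FR unfolding C_def by blast
qed

end
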